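(* Let $\kappa$ be a regular uncountable cardinal with $\kappa^{<\kappa}=\kappa$. If $X$ is a nonempty strong $\kappa$-Choquet space (Hausdorff, regular) of weight $\le\kappa$, then there is a continuous surjection $f\colon{}^\kappa\kappa\to X$. If $X$ is additionally $\kappa$-additive, then $f$ can be chosen to be open as well.
   Context: ${}^\kappa\kappa$ has the topology generated by $N_s=\{x: s\subset x\}$, $s\in{}^{<\kappa}\kappa$. A space is $\kappa$-additive if every intersection of fewer than $\kappa$ open sets is open. The strong $\kappa$-Choquet game on $X$: players I and II alternate for $\kappa$ rounds; in round $\alpha$, I plays $x_\alpha\in U_\alpha$ with $U_\alpha$ relatively open in $\bigcap_{\beta<\alpha}U_\beta$; II plays $V_\alpha$ relatively open in $U_\alpha$ with $x_\alpha\in V_\alpha$. II wins if $\bigcap_{\alpha<\lambda}U_\alpha\ne\emptyset$ for every limit $\lambda\le\kappa$. $X$ is strong $\kappa$-Choquet if II has a winning strategy. *)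

theory Defs
  imports "HOL-Analysis.Analysis"
begin

unbundle cardinal_syntax

text \<open>
  A cardinal \<open>\<kappa>\<close> is a relation \<open>r\<close> with \<^term>\<open>Card_order r\<close>.  Its elements \<open>\<alpha> \<in> Field r\<close> are
  the ordinals below \<open>\<kappa>\<close>, and \<open>underS r \<alpha>\<close> is the set of ordinals below \<open>\<alpha>\<close>.
\<close>

definition gen_Baire_set :: "'k rel \<Rightarrow> ('k \<Rightarrow> 'k) set" where
  "gen_Baire_set r = Field r \<rightarrow>\<^sub>E Field r"

text \<open>
  Sequences of length \<open>< \<kappa>\<close> carry their length \<open>\<alpha>\<close> explicitly: the default value outside the
  domain of an extensional function may belong to \<open>Field r\<close>, so the function alone need not
  determine it.
\<close>

definition short_seqs :: "'k rel \<Rightarrow> ('k \<times> ('k \<Rightarrow> 'k)) set" where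
  "short_seqs r = (SIGMA \<alpha>:Field r. underS r \<alpha> \<rightarrow>\<^sub>E Field r)"

definition basic_nbhd :: "'k rel \<Rightarrow> 'k \<times> ('k \<Rightarrow> 'k) \<Rightarrow> ('k \<Rightarrow> 'k) set" where
  "basic_nbhd r = (\<lambda>(\<alpha>, s). {x \<in> gen_Baire_set r. \<forall>\<beta>\<in>underS r \<alpha>. x \<beta> = s \<beta>})"

definition gen_Baire_space :: "'k rel \<Rightarrow> ('k \<Rightarrow> 'k) topology" where
  "gen_Baire_space r = topology_generated_by (basic_nbhd r ` short_seqs r)"

definition weight_le :: "'a topology \<Rightarrow> 'k rel \<Rightarrow> bool" where
  "weight_le X r \<longleftrightarrow>
     (\<exists>\<B>. |\<B>| \<le>o r \<and> (\<forall>B\<in>\<B>. openin X B) \<and>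
          (\<forall>U x. openin X U \<and> x \<in> U \<longrightarrow> (\<exists>B\<in>\<B>. x \<in> B \<and> B \<subseteq> U)))"

definition additive_space :: "'k rel \<Rightarrow> 'a topology \<Rightarrow> bool" where
  "additive_space r X \<longleftrightarrow>
     (\<forall>\<U>. |\<U>| <o r \<and> (\<forall>U\<in>\<U>. openin X U) \<longrightarrow> openin X (topspace X \<inter> \<Inter>\<U>))"

text \<open>
  The move \<open>(p \<alpha>, U \<alpha>)\<close> of player I must be relatively open in the intersection of all the
  previous answers \<open>V \<beta>\<close> of player II; at limit \<open>\<alpha>\<close> this intersection agrees with that of the
  \<open>U \<beta>\<close>.  In round 0 the intersection is \<open>UNIV\<close>, so that \<open>U \<alpha>\<close> is just open in \<open>X\<close>.
\<close>

definition legal_I ::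
  "'k rel \<Rightarrow> 'a topology \<Rightarrow> ('k \<Rightarrow> 'a) \<Rightarrow> ('k \<Rightarrow> 'a set) \<Rightarrow> ('k \<Rightarrow> 'a set) \<Rightarrow> 'k \<Rightarrow> bool" where
  "legal_I r X p U V \<alpha> \<longleftrightarrow>
     p \<alpha> \<in> U \<alpha> \<and> openin (subtopology X (\<Inter>\<beta>\<in>underS r \<alpha>. V \<beta>)) (U \<alpha>)"

definition legal_II ::
  "'a topology \<Rightarrow> ('k \<Rightarrow> 'a) \<Rightarrow> ('k \<Rightarrow> 'a set) \<Rightarrow> ('k \<Rightarrow> 'a set) \<Rightarrow> 'k \<Rightarrow> bool" where
  "legal_II X p U V \<alpha> \<longleftrightarrow> p \<alpha> \<in> V \<alpha> \<and> openin (subtopology X (U \<alpha>)) (V \<alpha>)"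

definition limit_segment :: "'k rel \<Rightarrow> 'k set \<Rightarrow> bool" where
  "limit_segment r S \<longleftrightarrow> S \<noteq> {} \<and> (\<forall>\<alpha>\<in>S. \<exists>\<beta>\<in>S. \<alpha> \<noteq> \<beta> \<and> (\<alpha>, \<beta>) \<in> r)"

text \<open>
  A strategy \<open>\<sigma>\<close> for player II answers in round \<open>\<alpha>\<close> to the moves of player I in the rounds
  \<open>\<le> \<alpha>\<close>; player II's own earlier moves are determined by these.
\<close>

definition reply ::
  "'k rel \<Rightarrow> ('k \<Rightarrow> ('k \<Rightarrow> 'a \<times> 'a set) \<Rightarrow> 'a set) \<Rightarrow> ('k \<Rightarrow> 'a) \<Rightarrow> ('k \<Rightarrow> 'a set) \<Rightarrow> 'k \<Rightarrow> 'a set"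
  where
  "reply r \<sigma> p U \<alpha> = \<sigma> \<alpha> (restrict (\<lambda>\<beta>. (p \<beta>, U \<beta>)) (under r \<alpha>))"

text \<open>
  The order filters \<open>S\<close> of \<open>r\<close> are exactly the initial segments of \<open>\<kappa>\<close>, \<open>Field r\<close> included, that
  is, the ordinals \<open>\<le> \<kappa>\<close>.  A play may break off at a limit \<open>\<lambda> < \<kappa>\<close> because player I has no legal
  move left, which is a loss for player II; hence partial plays of every length \<open>S\<close> are considered.
\<close>

definition winning_strategy_II ::
  "'k rel \<Rightarrow> 'a topology \<Rightarrow> ('k \<Rightarrow> ('k \<Rightarrow> 'a \<times> 'a set) \<Rightarrow> 'a set) \<Rightarrow> bool" where
  "winning_strategy_II r X \<sigma> \<longleftrightarrow>
     (\<forall>S p U. ofilter r S \<and> (\<forall>\<alpha>\<in>S. legal_I r X p U (reply r \<sigma> p U) \<alpha>) \<longrightarrow>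
        (\<forall>\<alpha>\<in>S. legal_II X p U (reply r \<sigma> p U) \<alpha>) \<and>
        (limit_segment r S \<longrightarrow> (\<Inter>\<alpha>\<in>S. U \<alpha>) \<noteq> {}))"

definition strong_Choquet :: "'k rel \<Rightarrow> 'a topology \<Rightarrow> bool" where
  "strong_Choquet r X \<longleftrightarrow> (\<exists>\<sigma>. winning_strategy_II r X \<sigma>)"

lemma topspace_gen_Baire_space:
  assumes "Card_order r" "Field r \<noteq> {}"
  shows "topspace (gen_Baire_space r) = gen_Baire_set r"
proof -
  have wo: "wo_rel r"
    using assms(1) by (simp add: wo_rel_def card_order_on_well_order_on)
  define z where "z = wo_rel.minim r (Field r)"
  have z: "z \<in> Field r" "underS r z = {}"
    using wo_rel.minim_in[OF wo, of "Field r"] wo_rel.minim_least[OF wo, of "Field r"] assms(2)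
      wo_rel.ANTISYM[OF wo]
    by (auto simp: z_def underS_def antisym_def Field_def)
  have "(z, \<lambda>_. undefined) \<in> short_seqs r"
    using z by (simp add: short_seqs_def)
  moreover have "basic_nbhd r (z, \<lambda>_. undefined) = gen_Baire_set r"
    using z by (simp add: basic_nbhd_def)
  ultimately show ?thesis
    unfolding gen_Baire_space_def topology_generated_by_topspace
    by (force simp: basic_nbhd_def)
qed

end

theory Submission
  imports Defs
begin

text \<open>
  A sequence \<open>x\<close> in the generalised Baire space is read as a play of player I against a winning
  strategy of player II. In round \<open>\<alpha>\<close> the intersection \<open>W\<close> of the previous answers is nonempty;
  by the weight bound, \<open>\<kappa>\<close> many of the answers to moves with points of \<open>W\<close> already cover \<open>W\<close>,
  and \<open>x \<alpha>\<close> selects one of them. Player I also shrinks his open sets so that every pair of basic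
  open sets \<open>(B, B')\<close> with \<open>closure B \<subseteq> B'\<close> is decided at some round; by regularity the
  intersection of the play is then a single point \<open>f x\<close> to which the moves shrink, so \<open>f\<close> is
  continuous. As the answers cover \<open>W\<close>, the image of the basic neighbourhood of a short sequence
  is exactly the corresponding \<open>W\<close>: hence \<open>f\<close> is onto, and open if \<open>X\<close> is \<open>\<kappa>\<close>-additive,
  because then each \<open>W\<close> is open in \<open>X\<close>.
\<close>

section \<open>Covers and shrinking families from the weight bound\<close>

lemma ordLeq_imp_surj:
  assumes "Card_order r" "|A| \<le>o r" "A \<noteq> {}"
  obtains g where "g ` Field r = A"
proof -
  have "|A| \<le>o |Field r|"
    using assms(1,2) card_of_Field_ordIso ordIso_symmetric ordLeq_ordIso_trans by blast
  then show ?thesis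
    using that card_of_ordLeq2[OF assms(3), of "Field r"] by auto
qed

lemma card_of_underS_ordLess:
  assumes "Card_order r" "\<alpha> \<in> Field r"
  shows "|f ` underS r \<alpha>| <o r"
  using card_of_underS[OF assms] card_of_image ordLeq_ordLess_trans by blast

text \<open>Every \<open>V q\<close> is a union of traces on \<open>W\<close> of basic open sets.
  Choosing one \<open>q\<close> for each basic set whose trace fits into some \<open>V q\<close>
  leaves at most kappa many points, and their sets still cover \<open>W\<close>.\<close>

lemma weight_le_indexed_cover:
  assumes r: "Card_order r" and wt: "weight_le X r"
    and W: "W \<noteq> {}" "W \<subseteq> topspace X"
    and V: "\<And>q. q \<in> W \<Longrightarrow> q \<in> V q \<and> openin (subtopology X W) (V q)"
  shows "\<exists>g. g ` Field r \<subseteq> W \<and> (\<Union>i\<in>Field r. V (g i)) = W"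
proof -
  obtain \<B> where \<B>: "|\<B>| \<le>o r" "\<And>B. B \<in> \<B> \<Longrightarrow> openin X B"
      "\<And>U x. openin X U \<Longrightarrow> x \<in> U \<Longrightarrow> \<exists>B\<in>\<B>. x \<in> B \<and> B \<subseteq> U"
    using wt unfolding weight_le_def by metis
  define \<C> where "\<C> = {B \<in> \<B>. \<exists>q\<in>W. B \<inter> W \<subseteq> V q}"
  have cov: "\<exists>B\<in>\<C>. q \<in> B" if q: "q \<in> W" for q
  proof -
    obtain T where T: "openin X T" "V q = T \<inter> W"
      using V[OF q] by (auto simp: openin_subtopology)
    then have "q \<in> T"
      using V[OF q] by auto
    then obtain B where "B \<in> \<B>" "q \<in> B" "B \<subseteq> T"
      using \<B>(3)[OF T(1)] by blast
    then have "B \<in> \<C>"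
      using q T unfolding \<C>_def by blast
    then show ?thesis
      using \<open>q \<in> B\<close> by blast
  qed
  have "|\<C>| \<le>o r"
    using \<B>(1) card_of_mono1[of \<C> \<B>] ordLeq_transitive unfolding \<C>_def by blast
  moreover have "\<C> \<noteq> {}"
    using W cov by blast
  ultimately obtain h where h: "h ` Field r = \<C>"
    using ordLeq_imp_surj[OF r] by metis
  define c where "c B = (SOME q. q \<in> W \<and> B \<inter> W \<subseteq> V q)" for B
  have c: "c B \<in> W \<and> B \<inter> W \<subseteq> V (c B)" if "B \<in> \<C>" for B
    unfolding c_def by (rule someI_ex) (use that in \<open>auto simp: \<C>_def\<close>)
  have sub: "V q \<subseteq> W" if "q \<in> W" for q
    using openin_imp_subset[of X W "V q"] V[OF that] by simp
  show ?thesis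
  proof (intro exI conjI)
    show "(\<lambda>i. c (h i)) ` Field r \<subseteq> W"
      using c h by blast
    show "(\<Union>i\<in>Field r. V (c (h i))) = W"
    proof
      show "(\<Union>i\<in>Field r. V (c (h i))) \<subseteq> W"
        using c h sub by blast
      show "W \<subseteq> (\<Union>i\<in>Field r. V (c (h i)))"
      proof
        fix q assume q: "q \<in> W"
        then obtain B where B: "B \<in> \<C>" "q \<in> B"
          using cov by blast
        then obtain i where "i \<in> Field r" "h i = B"
          using h by blast
        then show "q \<in> (\<Union>i\<in>Field r. V (c (h i)))"
          using c[OF B(1)] B q by blast
      qed
    qed
  qed
qed

text \<open>
  Regularity of \<open>X\<close>: stage \<open>\<alpha>\<close> treats one pair \<open>(B, B')\<close> of basic open sets with
  \<open>closure B \<subseteq> B'\<close>, shrinking to \<open>B'\<close> or away from \<open>closure B\<close>.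
\<close>

lemma shrinking_neighbourhoods:
  assumes r: "Card_order r" "\<not> finite (Field r)" and wt: "weight_le X r"
    and ne: "topspace X \<noteq> {}" and reg: "regular_space X"
  obtains D :: "'k \<Rightarrow> 'a \<Rightarrow> 'a set" where
    "\<And>\<alpha> p. \<alpha> \<in> Field (r :: 'k rel) \<Longrightarrow> openin X (D \<alpha> p)"
    "\<And>\<alpha> p. p \<in> topspace X \<Longrightarrow> p \<in> D \<alpha> p"
    "\<And>G y. openin X G \<Longrightarrow> y \<in> G \<Longrightarrow> \<exists>\<alpha>\<in>Field r. \<forall>p. y \<in> D \<alpha> p \<longrightarrow> D \<alpha> p \<subseteq> G"
proof -
  obtain \<B> where \<B>: "|\<B>| \<le>o r" "\<And>B. B \<in> \<B> \<Longrightarrow> openin X B"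
      "\<And>U x. openin X U \<Longrightarrow> x \<in> U \<Longrightarrow> \<exists>B\<in>\<B>. x \<in> B \<and> B \<subseteq> U"
    using wt unfolding weight_le_def by metis
  have "\<B> \<noteq> {}"
    using ne \<B>(3)[OF openin_topspace] by blast
  \<comment> \<open>Since kappa times kappa is kappa, all pairs of basic sets can be listed along
    the rounds.\<close>
  moreover have "|\<B> \<times> \<B>| \<le>o r"
    using card_of_Times_ordLeq_infinite_Field[OF r(2) \<B>(1) \<B>(1) r(1)] .
  ultimately obtain e where e: "e ` Field r = \<B> \<times> \<B>"
    using ordLeq_imp_surj[OF r(1), of "\<B> \<times> \<B>"] by auto
  define D where "D \<alpha> p =
     (if X closure_of fst (e \<alpha>) \<subseteq> snd (e \<alpha>)
      then if p \<in> snd (e \<alpha>) then snd (e \<alpha>) else topspace X - X closure_of fst (e \<alpha>)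
      else topspace X)" for \<alpha> p
  show ?thesis
  proof (rule that)
    show "openin X (D \<alpha> p)" if "\<alpha> \<in> Field r" for \<alpha> p
    proof -
      have "e \<alpha> \<in> \<B> \<times> \<B>"
        using that e by blast
      then have "openin X (snd (e \<alpha>))"
        using \<B>(2) by auto
      then show ?thesis
        by (simp add: D_def openin_diff)
    qed
    show "p \<in> D \<alpha> p" if "p \<in> topspace X" for \<alpha> p
      using that by (auto simp: D_def)
    show "\<exists>\<alpha>\<in>Field r. \<forall>p. y \<in> D \<alpha> p \<longrightarrow> D \<alpha> p \<subseteq> G" if G: "openin X G" "y \<in> G" for G y
    proof -
      obtain B' where B': "B' \<in> \<B>" "y \<in> B'" "B' \<subseteq> G"
        using \<B>(3)[OF G] by blast
      obtain U C where U: "openin X U" "closedin X C" "y \<in> U" "U \<subseteq> C" "C \<subseteq> B'"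
        using reg \<B>(2)[OF B'(1)] B'(2)
        unfolding neighbourhood_base_of_closedin[symmetric] neighbourhood_base_of by metis
      obtain B where B: "B \<in> \<B>" "y \<in> B" "B \<subseteq> U"
        using \<B>(3)[OF U(1,3)] by blast
      have cl: "X closure_of B \<subseteq> B'"
        using closure_of_minimal[of B C X] B U by blast
      have y: "y \<in> X closure_of B"
        using B closure_of_subset[OF openin_subset[OF \<B>(2)[OF B(1)]]] by blast
      obtain \<alpha> where "\<alpha> \<in> Field r" "e \<alpha> = (B, B')"
        using e B(1) B'(1) by (metis (no_types, lifting) SigmaI imageE)
      \<comment> \<open>As \<open>y\<close> lies in the closure of \<open>B\<close>, membership in
        \<open>D \<alpha> p\<close> rules out the complement alternative. So
        \<open>D \<alpha> p\<close> is \<open>B'\<close>, whatever \<open>p\<close> is.\<close>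
      then show ?thesis
        using cl y B'(3) by (intro bexI[of _ \<alpha>]) (auto simp: D_def)
    qed
  qed
qed

text \<open>Regularity enters only through \<open>D\<close>. In \<open>D_small\<close> the round is
  found before \<open>p\<close> is quantified, so it works for every point player I might choose in
  that round.\<close>

locale shrinking_choquet =
  fixes r :: "'k rel" and X :: "'a topology"
    and \<sigma> :: "'k \<Rightarrow> ('k \<Rightarrow> 'a \<times> 'a set) \<Rightarrow> 'a set"
    and D :: "'k \<Rightarrow> 'a \<Rightarrow> 'a set"
  assumes card: "Card_order r" and inf: "\<not> finite (Field r)"
    and weight: "weight_le X r" and nonempty: "topspace X \<noteq> {}"
    and haus: "Hausdorff_space X"
    and win: "winning_strategy_II r X \<sigma>"
    and D_open: "\<And>\<alpha> p. \<alpha> \<in> Field r \<Longrightarrow> openin X (D \<alpha> p)"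
    and D_mem: "\<And>\<alpha> p. p \<in> topspace X \<Longrightarrow> p \<in> D \<alpha> p"
    and D_small: "\<And>G y. openin X G \<Longrightarrow> y \<in> G \<Longrightarrow>
      \<exists>\<alpha>\<in>Field r. \<forall>p. y \<in> D \<alpha> p \<longrightarrow> D \<alpha> p \<subseteq> G"
begin

section \<open>Initial segments of kappa\<close>

lemma wo: "wo_rel r"
  using card by (simp add: wo_rel_def card_order_on_well_order_on)

lemma underS_trans: "\<gamma> \<in> underS r \<beta> \<Longrightarrow> \<beta> \<in> underS r \<alpha> \<Longrightarrow> \<gamma> \<in> underS r \<alpha>"
  using wo_rel.TRANS[OF wo] wo_rel.ANTISYM[OF wo]
  by (auto simp: underS_def trans_def antisym_def)

lemma under_trans: "\<gamma> \<in> under r \<beta> \<Longrightarrow> \<beta> \<in> underS r \<alpha> \<Longrightarrow> \<gamma> \<in> underS r \<alpha>"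
  using wo_rel.TRANS[OF wo] wo_rel.ANTISYM[OF wo]
  by (auto simp: underS_def under_def trans_def antisym_def)

lemma underS_under: "\<gamma> \<in> underS r \<beta> \<Longrightarrow> \<beta> \<in> under r \<alpha> \<Longrightarrow> \<gamma> \<in> underS r \<alpha>"
  using wo_rel.TRANS[OF wo] wo_rel.ANTISYM[OF wo]
  by (auto simp: underS_def under_def trans_def antisym_def)

lemma under_eq: "\<alpha> \<in> Field r \<Longrightarrow> under r \<alpha> = insert \<alpha> (underS r \<alpha>)"
  using wo_rel.REFL[OF wo] by (auto simp: underS_def under_def refl_on_def)

lemma under_cases: "\<beta> \<in> under r \<alpha> \<Longrightarrow> \<beta> = \<alpha> \<or> \<beta> \<in> underS r \<alpha>"
  by (auto simp: underS_def under_def)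

lemma underS_linear:
  "\<alpha> \<in> Field r \<Longrightarrow> \<beta> \<in> Field r \<Longrightarrow> \<alpha> \<in> underS r \<beta> \<or> \<alpha> = \<beta> \<or> \<beta> \<in> underS r \<alpha>"
  using wo_rel.TOTALS[OF wo] by (auto simp: underS_def)

lemma underS_in_Field: "\<beta> \<in> underS r \<alpha> \<Longrightarrow> \<beta> \<in> Field r"
  by (auto simp: underS_def Field_def)

lemma ex_greater: "\<alpha> \<in> Field r \<Longrightarrow> \<exists>\<beta>\<in>Field r. \<alpha> \<in> underS r \<beta>"
  using infinite_Card_order_limit[OF card inf] by (fastforce simp: underS_def)

section \<open>Plays determined by the points of player I\<close>

definition answer :: "('k \<Rightarrow> 'a) \<Rightarrow> 'k \<Rightarrow> 'a set" where
  "answer p = wo_rel.worec r (\<lambda>V \<alpha>.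
     \<sigma> \<alpha> (restrict (\<lambda>\<beta>. (p \<beta>, D \<beta> (p \<beta>) \<inter> (\<Inter>\<gamma>\<in>underS r \<beta>. V \<gamma>))) (under r \<alpha>)))"

text \<open>Player I always plays the largest set permitted by both the rules and \<open>D\<close>;
  a play is thus coded by its points alone.\<close>

definition move :: "('k \<Rightarrow> 'a) \<Rightarrow> 'k \<Rightarrow> 'a set" where
  "move p \<alpha> = D \<alpha> (p \<alpha>) \<inter> (\<Inter>\<beta>\<in>underS r \<alpha>. answer p \<beta>)"

text \<open>This is the set \<open>W\<close> of the overview. The factor \<open>topspace X\<close>
  matters in round 0, where the intersection of answers is \<open>UNIV\<close>.\<close>

definition arena :: "('k \<Rightarrow> 'a) \<Rightarrow> 'k \<Rightarrow> 'a set" where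
  "arena p \<alpha> = topspace X \<inter> (\<Inter>\<beta>\<in>underS r \<alpha>. answer p \<beta>)"

text \<open>The recursion for \<open>answer\<close> is the strategy applied to moves built from its
  own earlier values. It is admissible because the moves in rounds up to \<alpha> involve only
  answers strictly before \<alpha>.\<close>

lemma reply_move: "reply r \<sigma> p (move p) = answer p"
proof -
  let ?H = "\<lambda>V \<alpha>.
     \<sigma> \<alpha> (restrict (\<lambda>\<beta>. (p \<beta>, D \<beta> (p \<beta>) \<inter> (\<Inter>\<gamma>\<in>underS r \<beta>. V \<gamma>))) (under r \<alpha>))"
  have "wo_rel.adm_wo r ?H"
    unfolding wo_rel.adm_wo_def[OF wo]
  proof (intro allI impI)
    fix f g :: "'k \<Rightarrow> 'a set" and \<alpha>
    assume *: "\<forall>\<beta>\<in>underS r \<alpha>. f \<beta> = g \<beta>"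
    have "(\<Inter>\<gamma>\<in>underS r \<beta>. f \<gamma>) = (\<Inter>\<gamma>\<in>underS r \<beta>. g \<gamma>)" if "\<beta> \<in> under r \<alpha>" for \<beta>
      using * underS_under[OF _ that] by auto
    then show "?H f \<alpha> = ?H g \<alpha>"
      by (intro arg_cong[of _ _ "\<sigma> \<alpha>"] restrict_ext) auto
  qed
  from wo_rel.worec_fixpoint[OF wo this] have "answer p = ?H (answer p)"
    unfolding answer_def .
  then show ?thesis
    unfolding reply_def move_def by auto
qed

lemma answer_eq: "answer p \<alpha> = \<sigma> \<alpha> (restrict (\<lambda>\<beta>. (p \<beta>, move p \<beta>)) (under r \<alpha>))"
  using reply_move[of p] unfolding reply_def by metis

lemma answer_cong:
  assumes "\<And>\<beta>. \<beta> \<in> under r \<alpha> \<Longrightarrow> p \<beta> = q \<beta>"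
  shows "answer p \<alpha> = answer q \<alpha>"
  using assms
proof (induction \<alpha> rule: wo_rel.well_order_induct[OF wo])
  case (1 \<alpha>)
  have IH: "answer p \<gamma> = answer q \<gamma>" if "\<gamma> \<in> underS r \<alpha>" for \<gamma>
  proof -
    have "answer p \<gamma> = answer q \<gamma>"
      if "\<And>\<beta>. \<beta> \<in> under r \<gamma> \<Longrightarrow> p \<beta> = q \<beta>"
      using 1(1) \<open>\<gamma> \<in> underS r \<alpha>\<close> that by (auto simp: underS_def)
    moreover have "p \<beta> = q \<beta>" if "\<beta> \<in> under r \<gamma>" for \<beta>
      using 1(2) under_trans[OF that \<open>\<gamma> \<in> underS r \<alpha>\<close>] by (auto simp: underS_def under_def)
    ultimately show ?thesis by blast
  qed
  have "move p \<beta> = move q \<beta>" if "\<beta> \<in> under r \<alpha>" for \<beta>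
    using IH underS_under[OF _ that] 1(2)[OF that] by (auto simp: move_def)
  then have "restrict (\<lambda>\<beta>. (p \<beta>, move p \<beta>)) (under r \<alpha>) = restrict (\<lambda>\<beta>. (q \<beta>, move q \<beta>)) (under r \<alpha>)"
    by (intro restrict_ext) (use 1(2) in auto)
  then show ?case
    by (simp add: answer_eq)
qed

lemma answer_cong_underS:
  "(\<And>\<beta>. \<beta> \<in> underS r \<alpha> \<Longrightarrow> p \<beta> = q \<beta>) \<Longrightarrow> \<gamma> \<in> underS r \<alpha> \<Longrightarrow> answer p \<gamma> = answer q \<gamma>"
  by (rule answer_cong) (use under_trans in blast)

lemma arena_cong:
  "(\<And>\<beta>. \<beta> \<in> underS r \<alpha> \<Longrightarrow> p \<beta> = q \<beta>) \<Longrightarrow> arena p \<alpha> = arena q \<alpha>"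
  using answer_cong_underS[of \<alpha> p q] unfolding arena_def by auto

lemma move_cong:
  assumes "\<And>\<beta>. \<beta> \<in> under r \<alpha> \<Longrightarrow> p \<beta> = q \<beta>" "\<alpha> \<in> Field r"
  shows "move p \<alpha> = move q \<alpha>"
  using answer_cong_underS[of \<alpha> p q] assms under_eq[of \<alpha>] unfolding move_def by auto

lemma move_subset_arena: "\<alpha> \<in> Field r \<Longrightarrow> move p \<alpha> \<subseteq> arena p \<alpha>"
  using openin_subset[OF D_open] unfolding move_def arena_def by blast

lemma move_eq_arena: "\<alpha> \<in> Field r \<Longrightarrow> move p \<alpha> = D \<alpha> (p \<alpha>) \<inter> arena p \<alpha>"
  using openin_subset[OF D_open] unfolding move_def arena_def by blast

text \<open>With \<open>D_mem\<close>, a point in the arena is all that player I needs for a legal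
  move, so the winning strategy applies. General initial segments are allowed because plays are also
  cut off at \<open>underS r \<alpha>\<close> and \<open>under r \<alpha>\<close>.\<close>

lemma play_legal:
  assumes S: "ofilter r S" and p: "\<And>\<alpha>. \<alpha> \<in> S \<Longrightarrow> p \<alpha> \<in> arena p \<alpha>"
  shows "\<And>\<alpha>. \<alpha> \<in> S \<Longrightarrow> p \<alpha> \<in> answer p \<alpha>"
    and "\<And>\<alpha>. \<alpha> \<in> S \<Longrightarrow> openin (subtopology X (move p \<alpha>)) (answer p \<alpha>)"
    and "limit_segment r S \<Longrightarrow> (\<Inter>\<alpha>\<in>S. move p \<alpha>) \<noteq> {}"
proof -
  have sub: "S \<subseteq> Field r"
    using S by (simp add: ofilter_def)
  have "legal_I r X p (move p) (answer p) \<alpha>" if "\<alpha> \<in> S" for \<alpha>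
  proof -
    have "p \<alpha> \<in> move p \<alpha>"
      using p[OF that] D_mem[of "p \<alpha>" \<alpha>] by (auto simp: arena_def move_def)
    moreover have "openin (subtopology X (\<Inter>\<beta>\<in>underS r \<alpha>. answer p \<beta>)) (move p \<alpha>)"
      unfolding move_def openin_subtopology using D_open sub that by blast
    ultimately show ?thesis
      by (simp add: legal_I_def)
  qed
  then have "(\<forall>\<alpha>\<in>S. legal_II X p (move p) (answer p) \<alpha>) \<and>
      (limit_segment r S \<longrightarrow> (\<Inter>\<alpha>\<in>S. move p \<alpha>) \<noteq> {})"
    using win S unfolding winning_strategy_II_def
    by (metis (no_types, lifting) reply_move)
  then show "\<And>\<alpha>. \<alpha> \<in> S \<Longrightarrow> p \<alpha> \<in> answer p \<alpha>"
    "\<And>\<alpha>. \<alpha> \<in> S \<Longrightarrow> openin (subtopology X (move p \<alpha>)) (answer p \<alpha>)"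
    "limit_segment r S \<Longrightarrow> (\<Inter>\<alpha>\<in>S. move p \<alpha>) \<noteq> {}"
    unfolding legal_II_def by blast+
qed

lemma answer_subset_move:
  assumes "ofilter r S" "\<And>\<alpha>. \<alpha> \<in> S \<Longrightarrow> p \<alpha> \<in> arena p \<alpha>" "\<alpha> \<in> S"
  shows "answer p \<alpha> \<subseteq> move p \<alpha>"
  using openin_subset[OF play_legal(2)[OF assms(1,2,3)]] by auto

text \<open>Player I can always continue: this is where winning at limits below kappa is
  used.\<close>

lemma arena_nonempty:
  assumes \<alpha>: "\<alpha> \<in> Field r" and p: "\<And>\<beta>. \<beta> \<in> underS r \<alpha> \<Longrightarrow> p \<beta> \<in> arena p \<beta>"
  shows "arena p \<alpha> \<noteq> {}"
proof -
  let ?S = "underS r \<alpha>"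
  have S: "ofilter r ?S"
    using wo_rel.underS_ofilter[OF wo] .
  note F = underS_in_Field
  \<comment> \<open>Round zero, a limit round, or a successor round with \<beta> the immediate
    predecessor.\<close>
  consider "?S = {}" | "limit_segment r ?S"
    | \<beta> where "\<beta> \<in> ?S" "\<And>\<gamma>. \<gamma> \<in> ?S \<Longrightarrow> \<beta> \<noteq> \<gamma> \<Longrightarrow> (\<beta>, \<gamma>) \<notin> r"
    unfolding limit_segment_def by blast
  then show ?thesis
  proof cases
    case 1
    then show ?thesis
      using nonempty by (simp add: arena_def)
  next
    case 2
    then obtain y where y: "\<And>\<beta>. \<beta> \<in> ?S \<Longrightarrow> y \<in> move p \<beta>"
      using play_legal(3)[OF S p] by blast
    \<comment> \<open>At a limit some round follows \<beta>, and its move is contained in the answer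
      at \<beta>.\<close>
    have "y \<in> answer p \<beta>" if \<beta>: "\<beta> \<in> ?S" for \<beta>
    proof -
      obtain \<gamma> where "\<gamma> \<in> ?S" "\<beta> \<in> underS r \<gamma>"
        using 2 \<beta> unfolding limit_segment_def underS_def by blast
      then show ?thesis
        using y unfolding move_def by blast
    qed
    moreover have "y \<in> topspace X"
      using 2 y F move_subset_arena unfolding limit_segment_def arena_def by blast
    ultimately show ?thesis
      unfolding arena_def by blast
  next
    case 3
    \<comment> \<open>The last point played survives: its own answer must keep it, and the earlier
      answers contain its arena.\<close>
    have "p \<beta> \<in> answer p \<gamma>" if "\<gamma> \<in> ?S" for \<gamma>
    proof -
      have "\<gamma> = \<beta> \<or> \<gamma> \<in> underS r \<beta>"
        using underS_linear[OF F[OF 3(1)] F[OF that]] 3(2)[OF that] by (auto simp: underS_def)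
      then show ?thesis
        using play_legal(1)[OF S p 3(1)] p[OF 3(1)] unfolding arena_def by blast
    qed
    then show ?thesis
      using p[OF 3(1)] unfolding arena_def by blast
  qed
qed

text \<open>Supplies the hypotheses of the covering lemma. The rules make the answer open only in
  the move, but the move is an open set intersected with the arena.\<close>

lemma answer_update:
  assumes \<alpha>: "\<alpha> \<in> Field r" and p: "\<And>\<beta>. \<beta> \<in> underS r \<alpha> \<Longrightarrow> p \<beta> \<in> arena p \<beta>"
    and q: "q \<in> arena p \<alpha>"
  shows "q \<in> answer (p(\<alpha> := q)) \<alpha>"
    and "openin (subtopology X (arena p \<alpha>)) (answer (p(\<alpha> := q)) \<alpha>)"
proof -
  let ?p = "p(\<alpha> := q)"
  have S: "ofilter r (under r \<alpha>)"
    using wo_rel.under_ofilter[OF wo] .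
  have \<alpha>in: "\<alpha> \<in> under r \<alpha>"
    using under_eq[OF \<alpha>] by blast
  have agree: "?p \<gamma> = p \<gamma>" if "\<gamma> \<in> underS r \<alpha>" for \<gamma>
    using that by (auto simp: underS_def)
  have are: "arena ?p \<beta> = arena p \<beta>" if "\<beta> \<in> under r \<alpha>" for \<beta>
    by (rule arena_cong) (use agree underS_under that in blast)
  have leg: "?p \<beta> \<in> arena ?p \<beta>" if "\<beta> \<in> under r \<alpha>" for \<beta>
    using are[OF that] under_cases[OF that] p[of \<beta>] agree[of \<beta>] q by auto
  show "q \<in> answer ?p \<alpha>"
    using play_legal(1)[OF S leg \<alpha>in] by (simp only: fun_upd_same)
  obtain T where T: "openin X T" "answer ?p \<alpha> = T \<inter> move ?p \<alpha>"
    using play_legal(2)[OF S leg \<alpha>in] unfolding openin_subtopology by metis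
  have "move ?p \<alpha> = D \<alpha> q \<inter> arena p \<alpha>"
    using move_eq_arena[OF \<alpha>] are[OF \<alpha>in] by simp
  then have "answer ?p \<alpha> = (T \<inter> D \<alpha> q) \<inter> arena p \<alpha>"
    using T by auto
  moreover have "openin X (T \<inter> D \<alpha> q)"
    using T D_open[OF \<alpha>] by blast
  ultimately show "openin (subtopology X (arena p \<alpha>)) (answer ?p \<alpha>)"
    by (auto simp: openin_subtopology)
qed

section \<open>Indexed covers of the arenas, and branches through them\<close>

definition candidate :: "'k \<Rightarrow> ('k \<Rightarrow> 'a) \<Rightarrow> 'k \<Rightarrow> 'a" where
  "candidate \<alpha> p = (SOME g. g ` Field r \<subseteq> arena p \<alpha> \<and>
     (\<Union>i\<in>Field r. answer (p(\<alpha> := g i)) \<alpha>) = arena p \<alpha>)"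

lemma candidate_cover:
  assumes "\<alpha> \<in> Field r" and "\<And>\<beta>. \<beta> \<in> underS r \<alpha> \<Longrightarrow> p \<beta> \<in> arena p \<beta>"
  shows "candidate \<alpha> p ` Field r \<subseteq> arena p \<alpha>"
    and "(\<Union>i\<in>Field r. answer (p(\<alpha> := candidate \<alpha> p i)) \<alpha>) = arena p \<alpha>"
proof -
  have "\<exists>g. g ` Field r \<subseteq> arena p \<alpha> \<and> (\<Union>i\<in>Field r. answer (p(\<alpha> := g i)) \<alpha>) = arena p \<alpha>"
  proof (rule weight_le_indexed_cover[OF card weight])
    show "arena p \<alpha> \<noteq> {}"
      by (rule arena_nonempty[OF assms])
    show "arena p \<alpha> \<subseteq> topspace X"
      by (auto simp: arena_def)
    show "q \<in> answer (p(\<alpha> := q)) \<alpha> \<and>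
        openin (subtopology X (arena p \<alpha>)) (answer (p(\<alpha> := q)) \<alpha>)" if "q \<in> arena p \<alpha>" for q
      using answer_update[OF assms that] by (intro conjI)
  qed
  from someI_ex[OF this]
  show "candidate \<alpha> p ` Field r \<subseteq> arena p \<alpha>"
    "(\<Union>i\<in>Field r. answer (p(\<alpha> := candidate \<alpha> p i)) \<alpha>) = arena p \<alpha>"
    unfolding candidate_def by blast+
qed

lemma answer_update_cong:
  assumes "\<And>\<beta>. \<beta> \<in> underS r \<alpha> \<Longrightarrow> p \<beta> = q \<beta>"
  shows "answer (p(\<alpha> := a)) \<alpha> = answer (q(\<alpha> := a)) \<alpha>"
  by (rule answer_cong) (use assms under_cases in \<open>auto split: if_splits\<close>)

text \<open>Histories agreeing before \<alpha> make the defining predicates identical, so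
  \<open>SOME\<close> picks the same enumeration.\<close>

lemma candidate_cong:
  assumes "\<And>\<beta>. \<beta> \<in> underS r \<alpha> \<Longrightarrow> p \<beta> = q \<beta>"
  shows "candidate \<alpha> p = candidate \<alpha> q"
  unfolding candidate_def
  by (simp only: arena_cong[of \<alpha> p q, OF assms] answer_update_cong[of \<alpha> p q, OF assms])

text \<open>
  The index \<open>i \<alpha> p\<close> chosen in round \<open>\<alpha>\<close> may depend on the earlier points: this is how a branch
  through a prescribed point of \<open>X\<close> is found.
\<close>

definition branch :: "('k \<Rightarrow> ('k \<Rightarrow> 'a) \<Rightarrow> 'k) \<Rightarrow> 'k \<Rightarrow> 'a" where
  "branch i = wo_rel.worec r (\<lambda>p \<alpha>. candidate \<alpha> p (i \<alpha> p))"

abbreviation points :: "('k \<Rightarrow> 'k) \<Rightarrow> 'k \<Rightarrow> 'a" where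
  "points x \<equiv> branch (\<lambda>\<alpha> _. x \<alpha>)"

text \<open>The assumption on \<open>i\<close>, dependence on the past only, is what makes the
  recursion admissible.\<close>

lemma branch_eq:
  assumes "\<And>\<alpha> p q. (\<And>\<beta>. \<beta> \<in> underS r \<alpha> \<Longrightarrow> p \<beta> = q \<beta>) \<Longrightarrow> i \<alpha> p = i \<alpha> q"
  shows "branch i \<alpha> = candidate \<alpha> (branch i) (i \<alpha> (branch i))"
proof -
  have "wo_rel.adm_wo r (\<lambda>p \<alpha>. candidate \<alpha> p (i \<alpha> p))"
    unfolding wo_rel.adm_wo_def[OF wo]
  proof (intro allI impI)
    fix p q :: "'k \<Rightarrow> 'a" and \<alpha>
    assume "\<forall>\<beta>\<in>underS r \<alpha>. p \<beta> = q \<beta>"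
    then have "\<And>\<beta>. \<beta> \<in> underS r \<alpha> \<Longrightarrow> p \<beta> = q \<beta>"
      by blast
    then show "candidate \<alpha> p (i \<alpha> p) = candidate \<alpha> q (i \<alpha> q)"
      using candidate_cong[of \<alpha> p q] assms[of \<alpha> p q] by simp
  qed
  from wo_rel.worec_fixpoint[OF wo this]
  have "branch i = (\<lambda>\<alpha>. candidate \<alpha> (branch i) (i \<alpha> (branch i)))"
    unfolding branch_def .
  then show ?thesis
    by (rule fun_cong)
qed

lemma points_eq: "points x \<alpha> = candidate \<alpha> (points x) (x \<alpha>)"
  by (rule branch_eq) simp

text \<open>The recursion is required of \<open>p\<close> only up to \<alpha>, so that a branch
  following \<open>x\<close> just for an initial stretch can be compared with
  \<open>points x\<close>.\<close>

lemma points_unique: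
  assumes "\<And>\<beta>. \<beta> \<in> under r \<alpha> \<Longrightarrow> p \<beta> = candidate \<beta> p (x \<beta>)"
  shows "\<alpha> \<in> Field r \<Longrightarrow> points x \<alpha> = p \<alpha>"
  using assms
proof (induction \<alpha> rule: wo_rel.well_order_induct[OF wo])
  case (1 \<alpha>)
  have "points x \<beta> = p \<beta>" if "\<beta> \<in> underS r \<alpha>" for \<beta>
  proof -
    have "p \<gamma> = candidate \<gamma> p (x \<gamma>)" if "\<gamma> \<in> under r \<beta>" for \<gamma>
      using 1(3) under_trans[OF that \<open>\<beta> \<in> underS r \<alpha>\<close>] by (auto simp: underS_def under_def)
    then show ?thesis
      using 1(1) that underS_in_Field[OF that] by (auto simp: underS_def)
  qed
  then have "candidate \<alpha> (points x) = candidate \<alpha> p"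
    by (rule candidate_cong)
  moreover have "\<alpha> \<in> under r \<alpha>"
    using under_eq[OF 1(2)] by blast
  ultimately show ?case
    using 1(3) points_eq[of x \<alpha>] by metis
qed

lemma points_cong:
  assumes "\<alpha> \<in> Field r" "\<And>\<beta>. \<beta> \<in> under r \<alpha> \<Longrightarrow> x \<beta> = y \<beta>"
  shows "points x \<alpha> = points y \<alpha>"
  by (rule points_unique[OF _ assms(1)]) (use assms(2) points_eq in metis)

lemma branch_in_arena:
  assumes i: "\<And>\<alpha> p q. (\<And>\<beta>. \<beta> \<in> underS r \<alpha> \<Longrightarrow> p \<beta> = q \<beta>) \<Longrightarrow> i \<alpha> p = i \<alpha> q"
    and "ofilter r S" "\<And>\<alpha>. \<alpha> \<in> S \<Longrightarrow> i \<alpha> (branch i) \<in> Field r" "\<alpha> \<in> S"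
  shows "branch i \<alpha> \<in> arena (branch i) \<alpha>"
  using assms(4)
proof (induction \<alpha> rule: wo_rel.well_order_induct[OF wo])
  case (1 \<alpha>)
  have \<alpha>: "\<alpha> \<in> Field r" "underS r \<alpha> \<subseteq> S"
    using assms(2) 1(2) by (auto simp: ofilter_def under_def underS_def)
  have "branch i \<beta> \<in> arena (branch i) \<beta>" if "\<beta> \<in> underS r \<alpha>" for \<beta>
    using 1(1) that \<alpha>(2) by (auto simp: underS_def)
  from candidate_cover(1)[OF \<alpha>(1) this]
  have "candidate \<alpha> (branch i) (i \<alpha> (branch i)) \<in> arena (branch i) \<alpha>"
    using assms(3)[OF 1(2)] by blast
  then show ?case
    by (subst branch_eq[OF i])
qed

lemma points_in_arena:
  assumes "ofilter r S" "\<And>\<alpha>. \<alpha> \<in> S \<Longrightarrow> x \<alpha> \<in> Field r" "\<alpha> \<in> S"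
  shows "points x \<alpha> \<in> arena (points x) \<alpha>"
  by (rule branch_in_arena[OF _ assms(1) _ assms(3)]) (use assms(2) in auto)

lemma Field_ofilter: "ofilter r (Field r)"
  by (simp add: wo_rel.Field_ofilter[OF wo])

lemma limit_segment_Field: "limit_segment r (Field r)"
  using ex_greater inf unfolding limit_segment_def underS_def by fastforce

section \<open>The limit map and its images of basic neighbourhoods\<close>

definition limit_point :: "('k \<Rightarrow> 'k) \<Rightarrow> 'a" where
  "limit_point x = (SOME y. \<forall>\<alpha>\<in>Field r. y \<in> move (points x) \<alpha>)"

text \<open>Winning the play of full length kappa makes the choice in \<open>limit_point\<close>
  meaningful.\<close>

lemma limit_point_in_move:
  assumes "x \<in> gen_Baire_set r" "\<alpha> \<in> Field r"
  shows "limit_point x \<in> move (points x) \<alpha>"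
proof -
  have "\<And>\<alpha>. \<alpha> \<in> Field r \<Longrightarrow> x \<alpha> \<in> Field r"
    using assms(1) by (auto simp: gen_Baire_set_def)
  then have "points x \<alpha> \<in> arena (points x) \<alpha>" if "\<alpha> \<in> Field r" for \<alpha>
    using points_in_arena[OF Field_ofilter _ that] by blast
  from play_legal(3)[OF Field_ofilter this limit_segment_Field]
  have "\<exists>y. \<forall>\<alpha>\<in>Field r. y \<in> move (points x) \<alpha>"
    by blast
  from someI_ex[OF this] show ?thesis
    using assms(2) unfolding limit_point_def by blast
qed

lemma move_small:
  assumes "openin X G" "y \<in> G" "\<And>\<alpha>. \<alpha> \<in> Field r \<Longrightarrow> y \<in> move p \<alpha>"
  shows "\<exists>\<alpha>\<in>Field r. move p \<alpha> \<subseteq> G"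
  using D_small[OF assms(1,2)] assms(3) unfolding move_def by blast

lemma Field_nonempty: "Field r \<noteq> {}"
  using inf by auto

lemma limit_point_in_topspace:
  assumes "x \<in> gen_Baire_set r"
  shows "limit_point x \<in> topspace X"
  using limit_point_in_move[OF assms] move_subset_arena Field_nonempty
  unfolding arena_def by blast

text \<open>Of two points common to all moves, one would have a neighbourhood missing the other, yet
  by \<open>move_small\<close> some move lies inside it.\<close>

lemma limit_point_unique:
  assumes x: "x \<in> gen_Baire_set r" and y: "\<And>\<alpha>. \<alpha> \<in> Field r \<Longrightarrow> y \<in> move (points x) \<alpha>"
  shows "limit_point x = y"
proof (rule ccontr)
  assume "limit_point x \<noteq> y"
  moreover have "y \<in> topspace X"
    using y move_subset_arena Field_nonempty unfolding arena_def by blast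
  ultimately obtain U V where "openin X U" "openin X V" "limit_point x \<in> U" "y \<in> V" "disjnt U V"
    using haus limit_point_in_topspace[OF x] unfolding Hausdorff_space_def by blast
  then show False
    using move_small[OF _ _ limit_point_in_move[OF x]] y unfolding disjnt_def by blast
qed

text \<open>One inclusion holds because the arena at \<delta> depends only on the indices before
  \<delta>. For the other, a branch is steered towards a given point of the arena.\<close>

lemma limit_point_image:
  assumes \<delta>: "\<delta> \<in> Field r" and s: "\<And>\<alpha>. \<alpha> \<in> underS r \<delta> \<Longrightarrow> s \<alpha> \<in> Field r"
  shows "limit_point ` basic_nbhd r (\<delta>, s) = arena (points s) \<delta>"
proof
  show "limit_point ` basic_nbhd r (\<delta>, s) \<subseteq> arena (points s) \<delta>"
  proof clarify
    fix x assume x: "x \<in> basic_nbhd r (\<delta>, s)"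
    then have "points x \<beta> = points s \<beta>" if "\<beta> \<in> underS r \<delta>" for \<beta>
      using underS_in_Field[OF that] under_trans[OF _ that]
      by (intro points_cong) (auto simp: basic_nbhd_def)
    then have "arena (points x) \<delta> = arena (points s) \<delta>"
      by (rule arena_cong)
    then show "limit_point x \<in> arena (points s) \<delta>"
      using limit_point_in_move[of x \<delta>] x \<delta> move_subset_arena by (auto simp: basic_nbhd_def)
  qed
next
  show "arena (points s) \<delta> \<subseteq> limit_point ` basic_nbhd r (\<delta>, s)"
  proof
    fix y assume y: "y \<in> arena (points s) \<delta>"
    \<comment> \<open>Before \<delta> the indices are those of \<open>s\<close>; from \<delta> on,
      an index is picked whose answer retains \<open>y\<close>.\<close>
    define i where "i \<alpha> p = (if \<alpha> \<in> underS r \<delta> then s \<alpha>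
        else SOME j. j \<in> Field r \<and> (y \<in> arena p \<alpha> \<longrightarrow> y \<in> answer (p(\<alpha> := candidate \<alpha> p j)) \<alpha>))"
      for \<alpha> p
    have icong: "i \<alpha> p = i \<alpha> q" if "\<And>\<beta>. \<beta> \<in> underS r \<alpha> \<Longrightarrow> p \<beta> = q \<beta>" for \<alpha> p q
      unfolding i_def
      by (simp only: arena_cong[of \<alpha> p q, OF that] candidate_cong[of \<alpha> p q, OF that]
          answer_update_cong[of \<alpha> p q, OF that])
    define p where "p = branch i"
    have p_eq: "p \<alpha> = candidate \<alpha> p (i \<alpha> p)" for \<alpha>
      unfolding p_def by (rule branch_eq[OF icong])
    have ps: "points s \<alpha> = p \<alpha>" if "\<alpha> \<in> underS r \<delta>" for \<alpha>
    proof (rule points_unique)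
      show "p \<beta> = candidate \<beta> p (s \<beta>)" if "\<beta> \<in> under r \<alpha>" for \<beta>
        using p_eq[of \<beta>] under_trans[OF that \<open>\<alpha> \<in> underS r \<delta>\<close>] by (simp add: i_def)
      show "\<alpha> \<in> Field r"
        using underS_in_Field[OF that] .
    qed
    have y\<delta>: "y \<in> arena p \<delta>"
      using y arena_cong[of \<delta> "points s" p, OF ps] by blast
    \<comment> \<open>Legality and retention of \<open>y\<close> need a joint induction: legality of
      the past gives the cover of the arena, and \<open>y\<close> in all past answers puts
      \<open>y\<close> into that arena.\<close>
    have step: "i \<alpha> p \<in> Field r \<and> p \<alpha> \<in> arena p \<alpha> \<and> y \<in> answer p \<alpha>" if "\<alpha> \<in> Field r" for \<alpha>
      using that
    proof (induction \<alpha> rule: wo_rel.well_order_induct[OF wo])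
      case (1 \<alpha>)
      have IH: "p \<beta> \<in> arena p \<beta>" "y \<in> answer p \<beta>" if "\<beta> \<in> underS r \<alpha>" for \<beta>
        using 1(1) that underS_in_Field[OF that] by (auto simp: underS_def)
      note cov = candidate_cover[OF 1(2) IH(1)]
      have y\<alpha>: "y \<in> arena p \<alpha>"
        using IH(2) y\<delta> unfolding arena_def by blast
      have i: "i \<alpha> p \<in> Field r \<and> y \<in> answer (p(\<alpha> := candidate \<alpha> p (i \<alpha> p))) \<alpha>"
      proof (cases "\<alpha> \<in> underS r \<delta>")
        case True
        \<comment> \<open>Here \<open>s\<close> leaves no choice, but the arena at \<delta> already
          lies inside this answer.\<close>
        have "y \<in> answer p \<alpha>"
          using y\<delta> True unfolding arena_def by blast
        then show ?thesis
          using s True p_eq[of \<alpha>] by (metis fun_upd_triv i_def)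
      next
        case False
        have "\<exists>j. j \<in> Field r \<and> (y \<in> arena p \<alpha> \<longrightarrow> y \<in> answer (p(\<alpha> := candidate \<alpha> p j)) \<alpha>)"
          using cov(2) y\<alpha> by blast
        from someI_ex[OF this] show ?thesis
          using False y\<alpha> unfolding i_def by simp
      qed
      then show ?case
        using cov(1) p_eq[of \<alpha>] by (metis fun_upd_triv image_subset_iff)
    qed
    \<comment> \<open>Evaluating the history-dependent selector along its own branch turns it into a
      fixed sequence with the same points.\<close>
    define x where "x = restrict (\<lambda>\<alpha>. i \<alpha> p) (Field r)"
    have x: "x \<in> gen_Baire_set r"
      using step by (auto simp: x_def gen_Baire_set_def)
    have px: "points x \<alpha> = p \<alpha>" if "\<alpha> \<in> Field r" for \<alpha>
      using that
    proof (rule points_unique[rotated])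
      show "p \<beta> = candidate \<beta> p (x \<beta>)" if "\<beta> \<in> under r \<alpha>" for \<beta>
        using that p_eq[of \<beta>] by (auto simp: x_def under_def Field_def)
    qed
    have "y \<in> move (points x) \<alpha>" if \<alpha>: "\<alpha> \<in> Field r" for \<alpha>
    proof -
      have "move (points x) \<alpha> = move p \<alpha>"
        by (rule move_cong[OF _ \<alpha>], rule px) (auto simp: under_def Field_def)
      then show ?thesis
        using answer_subset_move[OF Field_ofilter _ \<alpha>, of p] step \<alpha> by blast
    qed
    then have "limit_point x = y"
      by (rule limit_point_unique[OF x])
    moreover have "x \<in> basic_nbhd r (\<delta>, s)"
      using x underS_in_Field by (auto simp: basic_nbhd_def x_def i_def)
    ultimately show "y \<in> limit_point ` basic_nbhd r (\<delta>, s)"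
      by blast
  qed
qed

section \<open>Neighbourhoods in generalised Baire space\<close>

lemma topspace_Baire: "topspace (gen_Baire_space r) = gen_Baire_set r"
  using topspace_gen_Baire_space[OF card Field_nonempty] .

lemma openin_basic_nbhd: "(\<delta>, s) \<in> short_seqs r \<Longrightarrow> openin (gen_Baire_space r) (basic_nbhd r (\<delta>, s))"
  unfolding gen_Baire_space_def by (rule topology_generated_by_Basis) blast

text \<open>Lets \<open>x\<close> itself stand for its restriction, which \<open>short_seqs\<close>
  demands to be extensional.\<close>

lemma gen_Baire_nbhd:
  assumes "x \<in> gen_Baire_set r" "\<delta> \<in> Field r"
  shows "(\<delta>, restrict x (underS r \<delta>)) \<in> short_seqs r"
    and "basic_nbhd r (\<delta>, restrict x (underS r \<delta>)) = basic_nbhd r (\<delta>, x)"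
    and "x \<in> basic_nbhd r (\<delta>, x)"
  using assms underS_in_Field
  by (auto simp: short_seqs_def basic_nbhd_def gen_Baire_set_def)

lemma openin_gen_Baire_nbhd:
  "x \<in> gen_Baire_set r \<Longrightarrow> \<delta> \<in> Field r \<Longrightarrow> openin (gen_Baire_space r) (basic_nbhd r (\<delta>, x))"
  using openin_basic_nbhd gen_Baire_nbhd by metis

lemma basic_nbhd_mono:
  assumes "\<alpha> \<in> Field r" "\<beta> \<in> Field r"
  shows "\<exists>\<gamma>\<in>{\<alpha>, \<beta>}. basic_nbhd r (\<gamma>, x) \<subseteq> basic_nbhd r (\<alpha>, x) \<inter> basic_nbhd r (\<beta>, x)"
  using underS_linear[OF assms] underS_trans by (fastforce simp: basic_nbhd_def)

text \<open>The generating sets form a base, not just a subbase, because those around a fixed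
  \<open>x\<close> are nested.\<close>

lemma gen_Baire_base:
  assumes "openin (gen_Baire_space r) A" "x \<in> A"
  shows "\<exists>\<delta>\<in>Field r. basic_nbhd r (\<delta>, x) \<subseteq> A"
proof -
  have "generate_topology_on (basic_nbhd r ` short_seqs r) A"
    using assms(1) unfolding gen_Baire_space_def openin_topology_generated_by_iff .
  then show ?thesis
    using assms(2)
  proof (induction)
    case Empty
    then show ?case by simp
  next
    case (Int a b)
    then obtain \<alpha> \<beta> where *: "\<alpha> \<in> Field r" "\<beta> \<in> Field r"
      "basic_nbhd r (\<alpha>, x) \<subseteq> a" "basic_nbhd r (\<beta>, x) \<subseteq> b"
      by blast
    then obtain \<gamma> where "\<gamma> \<in> {\<alpha>, \<beta>}"
      "basic_nbhd r (\<gamma>, x) \<subseteq> basic_nbhd r (\<alpha>, x) \<inter> basic_nbhd r (\<beta>, x)"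
      using basic_nbhd_mono by metis
    with * show ?case
      by (intro bexI[of _ \<gamma>]) auto
  next
    case (UN K)
    then show ?case by blast
  next
    case (Basis b)
    then obtain \<delta> s where b: "b = basic_nbhd r (\<delta>, s)" "(\<delta>, s) \<in> short_seqs r"
      by auto
    then show ?case
      using Basis(2) by (intro bexI[of _ \<delta>]) (auto simp: basic_nbhd_def short_seqs_def)
  qed
qed

section \<open>Continuity, surjectivity and openness of the limit map\<close>

lemma continuous_limit_point: "continuous_map (gen_Baire_space r) X limit_point"
  unfolding continuous_map_def topspace_Baire
proof (intro conjI allI impI)
  show "limit_point \<in> gen_Baire_set r \<rightarrow> topspace X"
    using limit_point_in_topspace by blast
  fix G assume G: "openin X G"
  show "openin (gen_Baire_space r) {x \<in> gen_Baire_set r. limit_point x \<in> G}"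
  proof (subst openin_subopen, clarify)
    fix x assume x: "x \<in> gen_Baire_set r" "limit_point x \<in> G"
    obtain \<alpha> where \<alpha>: "\<alpha> \<in> Field r" "move (points x) \<alpha> \<subseteq> G"
      using move_small[OF G x(2) limit_point_in_move[OF x(1)]] by blast
    \<comment> \<open>The move at \<alpha> depends on \<open>x \<alpha>\<close> too, whereas a
      neighbourhood of length \<alpha> fixes only earlier values; hence a longer one.\<close>
    obtain \<beta> where \<beta>: "\<beta> \<in> Field r" "\<alpha> \<in> underS r \<beta>"
      using ex_greater[OF \<alpha>(1)] by blast
    have "limit_point y \<in> G" if y: "y \<in> basic_nbhd r (\<beta>, x)" for y
    proof -
      have "points y \<gamma> = points x \<gamma>" if "\<gamma> \<in> under r \<alpha>" for \<gamma>
      proof (rule points_cong)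
        have \<gamma>: "\<gamma> \<in> underS r \<beta>"
          using under_trans[OF that \<beta>(2)] .
        then show "\<gamma> \<in> Field r"
          by (rule underS_in_Field)
        show "y \<xi> = x \<xi>" if "\<xi> \<in> under r \<gamma>" for \<xi>
          using under_trans[OF that \<gamma>] y by (auto simp: basic_nbhd_def)
      qed
      then have "move (points y) \<alpha> = move (points x) \<alpha>"
        using move_cong \<alpha>(1) by blast
      then show ?thesis
        using limit_point_in_move[of y \<alpha>] y \<alpha> by (auto simp: basic_nbhd_def)
    qed
    then show "\<exists>T. openin (gen_Baire_space r) T \<and> x \<in> T \<and>
        T \<subseteq> {x \<in> gen_Baire_set r. limit_point x \<in> G}"
      using openin_gen_Baire_nbhd[OF x(1) \<beta>(1)] gen_Baire_nbhd(3)[OF x(1) \<beta>(1)]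
      by (intro exI[of _ "basic_nbhd r (\<beta>, x)"]) (auto simp: basic_nbhd_def)
  qed
qed

text \<open>The case of length zero in \<open>limit_point_image\<close>; no value of the sequence
  \<open>undefined\<close> is consulted.\<close>

lemma limit_point_onto: "limit_point ` gen_Baire_set r = topspace X"
proof -
  obtain z where z: "z \<in> Field r" "underS r z = {}"
  proof
    show "wo_rel.minim r (Field r) \<in> Field r"
      using wo_rel.minim_in[OF wo _ Field_nonempty] by blast
    show "underS r (wo_rel.minim r (Field r)) = {}"
      using wo_rel.minim_least[OF wo subset_refl] wo_rel.ANTISYM[OF wo]
      by (auto simp: underS_def antisym_def Field_def)
  qed
  then have "basic_nbhd r (z, undefined) = gen_Baire_set r"
    by (auto simp: basic_nbhd_def)
  moreover have "arena (points undefined) z = topspace X"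
    using z by (simp add: arena_def)
  ultimately show ?thesis
    using limit_point_image[of z undefined] z by simp
qed

text \<open>By induction each earlier arena is open, hence so are its move and its answer; the arena
  at \<alpha> intersects fewer than kappa answers, so additivity applies.\<close>

lemma openin_arena:
  assumes add: "additive_space r X"
    and S: "ofilter r S" "\<And>\<alpha>. \<alpha> \<in> S \<Longrightarrow> p \<alpha> \<in> arena p \<alpha>"
    and \<alpha>: "\<alpha> \<in> Field r" "underS r \<alpha> \<subseteq> S"
  shows "openin X (arena p \<alpha>)"
  using \<alpha>
proof (induction \<alpha> rule: wo_rel.well_order_induct[OF wo])
  case (1 \<alpha>)
  have "openin X (answer p \<beta>)" if "\<beta> \<in> underS r \<alpha>" for \<beta>
  proof -
    have \<beta>: "\<beta> \<in> S" "\<beta> \<in> Field r"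
      using that 1(3) underS_in_Field by auto
    have "openin X (arena p \<beta>)"
      using 1(1,3) that \<beta> underS_trans[OF _ that] by (auto simp: underS_def)
    then have "openin X (move p \<beta>)"
      using move_eq_arena[OF \<beta>(2)] D_open[OF \<beta>(2)] by (simp add: openin_Int)
    then show ?thesis
      using play_legal(2)[OF S \<beta>(1)] openin_trans_full by blast
  qed
  then show ?case
    using add card_of_underS_ordLess[OF card 1(2), of "answer p"]
    unfolding additive_space_def arena_def by blast
qed

lemma open_map_limit_point:
  assumes add: "additive_space r X"
  shows "open_map (gen_Baire_space r) X limit_point"
  unfolding open_map_def
proof (intro allI impI)
  fix A assume A: "openin (gen_Baire_space r) A"
  show "openin X (limit_point ` A)"
  proof (subst openin_subopen, clarify)
    fix x assume x: "x \<in> A"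
    then have xB: "x \<in> gen_Baire_set r"
      using openin_subset[OF A] topspace_Baire by blast
    then have F: "\<And>\<alpha>. \<alpha> \<in> Field r \<Longrightarrow> x \<alpha> \<in> Field r"
      by (auto simp: gen_Baire_set_def)
    obtain \<delta> where \<delta>: "\<delta> \<in> Field r" "basic_nbhd r (\<delta>, x) \<subseteq> A"
      using gen_Baire_base[OF A x] by blast
    have "limit_point ` basic_nbhd r (\<delta>, x) = arena (points x) \<delta>"
      by (rule limit_point_image[OF \<delta>(1)]) (use F underS_in_Field in blast)
    moreover have "openin X (arena (points x) \<delta>)"
      by (rule openin_arena[OF add Field_ofilter points_in_arena[OF Field_ofilter F] \<delta>(1)])
        (use underS_in_Field in auto)
    ultimately show "\<exists>T. openin X T \<and> limit_point x \<in> T \<and> T \<subseteq> limit_point ` A"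
      using \<delta>(2) gen_Baire_nbhd(3)[OF xB \<delta>(1)] by (metis image_eqI image_mono)
  qed
qed

end

theorem theorem3p5:
  fixes r :: "'k rel" and X :: "'a topology"
  assumes "Card_order r" and "natLeq <o r" and "regularCard r"
    and "|short_seqs r| =o r"
    and "topspace X \<noteq> {}"
    and "Hausdorff_space X" and "regular_space X"
    and "weight_le X r"
    and "strong_Choquet r X"
  shows "(\<exists>f. continuous_map (gen_Baire_space r) X f \<and>
              f ` topspace (gen_Baire_space r) = topspace X) \<and>
         (additive_space r X \<longrightarrow>
           (\<exists>f. continuous_map (gen_Baire_space r) X f \<and>
                f ` topspace (gen_Baire_space r) = topspace X \<and>
                open_map (gen_Baire_space r) X f))"
proof -
  have inf: "\<not> finite (Field r)"
    using cinfinite_mono[OF ordLess_imp_ordLeq[OF assms(2)] natLeq_cinfinite]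
    by (simp add: cinfinite_def)
  obtain \<sigma> where \<sigma>: "winning_strategy_II r X \<sigma>"
    using assms(9) unfolding strong_Choquet_def by blast
  obtain D where D: "\<And>\<alpha> p. \<alpha> \<in> Field r \<Longrightarrow> openin X (D \<alpha> p)"
    "\<And>\<alpha> p. p \<in> topspace X \<Longrightarrow> p \<in> D \<alpha> p"
    "\<And>G y. openin X G \<Longrightarrow> y \<in> G \<Longrightarrow> \<exists>\<alpha>\<in>Field r. \<forall>p. y \<in> D \<alpha> p \<longrightarrow> D \<alpha> p \<subseteq> G"
    using shrinking_neighbourhoods[OF assms(1) inf assms(8,5,7)] by metis
  interpret shrinking_choquet r X \<sigma> D
    using assms(1) inf assms(8,5,6) \<sigma> D by unfold_locales
  show ?thesis
    \<comment> \<open>The same map \<open>limit_point\<close> witnesses both claims; additivity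
      enters only for its openness.\<close>
    using continuous_limit_point limit_point_onto open_map_limit_point topspace_Baire by metis
qed

end
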